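(* Suppose that the exact solution $y$ of the initial value problem $y'(t)=f(y(t))=J^{-1}\nabla H(y(t))$, $y(t_0)=y_0$, on $I=[t_0,T]$ is a piecewise $X$-type function. Then the FFCFE$r$ method solves this initial value problem without any error, i.e. its finite element solution $U$ satisfies $U(t)=y(t)$ for all $t\in I$.
   Context: Setting. $d=2d_1$, $f:\mathbb{R}^d\to\mathbb{R}^d$ and $H:\mathbb{R}^d\to\mathbb{R}$ are sufficiently smooth (may be read as $C^\infty$), $f=J^{-1}\nabla H$, where $J=\begin{pmatrix}O&I\\-I&O\end{pmatrix}$ with $d_1\times d_1$ blocks, and $y_0\in\mathbb{R}^d$. The interval $I=[t_0,T]$ is partitioned by $t_n=t_0+nh$, $n=0,\ldots,N$, $t_N=T$, $h>0$. Function spaces. Let $\varphi_0,\ldots,\varphi_{r-1}$ be sufficiently smooth real-valued functions of a real variable, linearly independent on $I$. For scalar functions $\psi_i$, $\mathrm{span}\{\psi_0,\ldots,\psi_k\}$ denotes the space of $\mathbb{R}^d$-valued functions $\sum_i W_i\psi_i(t)$ with $W_i\in\mathbb{R}^d$. Put $$Y=\mathrm{span}\{\varphi_0(t),\ldots,\varphi_{r-1}(t)\},\qquad X=\mathrm{span}\Big\{1,\int_{t_0}^t\varphi_0(s)\,ds,\ldots,\int_{t_0}^t\varphi_{r-1}(s)\,ds\Big\}.$$ $Y$ is assumed invariant under translation and reflection: if $v(t)\in Y$ then $v(t+c)\in Y$ for every $c\in\mathbb{R}$ and $v(-t)\in Y$. A function $w$ on $I$ is called piecewise $Y$-type (resp.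 piecewise $X$-type) if for every $0\le n\le N-1$ there is $g\in Y$ (resp. $g\in X$) with $w|_{(t_n,t_{n+1})}=g|_{(t_n,t_{n+1})}$. FFCFE$r$ method (functionally-fitted continuous finite element method). Find a continuous piecewise $X$-type function $U$ on $I$ with $U(t_0)=y_0$ such that $$\int_I v(t)\cdot\big(U'(t)-f(U(t))\big)\,dt=0\quad\text{for every piecewise } Y\text{-type function } v,$$ where $\cdot$ is entrywise multiplication of vectors. It is presumed that this variational problem has a unique solution $U$. *)

theory Defs
  imports "HOL-Analysis.Analysis"
begin

text \<open>All iterated directional derivatives of order \<open>< k\<close> are Frechet differentiable and those of
  order \<open>k\<close> are continuous; for finite-dimensional domains this is \<open>C\<^sup>k\<close>.\<close>

primrec Ck :: "nat \<Rightarrow> ('a::real_normed_vector \<Rightarrow> 'b::real_normed_vector) \<Rightarrow> bool" where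
  "Ck 0 f \<longleftrightarrow> continuous_on UNIV f"
| "Ck (Suc k) f \<longleftrightarrow> (\<forall>x. f differentiable (at x)) \<and>
     (\<forall>v. Ck k (\<lambda>x. frechet_derivative f (at x) v))"

definition smooth :: "('a::real_normed_vector \<Rightarrow> 'b::real_normed_vector) \<Rightarrow> bool" where
  "smooth f \<longleftrightarrow> (\<forall>k. Ck k f)"

text \<open>The index type \<open>'n + 'n\<close> encodes the even dimension \<open>d = 2 d\<^sub>1\<close> with
  \<open>d\<^sub>1 = CARD('n)\<close>: \<open>Inl\<close> and \<open>Inr\<close> are the first and the second block of coordinates.\<close>

definition J_mat :: "real ^ ('n::finite + 'n) ^ ('n + 'n)" where
  "J_mat = (\<chi> i j. case (i, j) of
      (Inl a, Inr b) \<Rightarrow> (mat 1 :: real^'n^'n) $ a $ b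
    | (Inr a, Inl b) \<Rightarrow> - (mat 1 :: real^'n^'n) $ a $ b
    | _ \<Rightarrow> 0)"

definition lin_indep_on :: "nat \<Rightarrow> (nat \<Rightarrow> real \<Rightarrow> real) \<Rightarrow> real set \<Rightarrow> bool" where
  "lin_indep_on r \<phi> I \<longleftrightarrow>
     (\<forall>c :: nat \<Rightarrow> real. (\<forall>t\<in>I. (\<Sum>i<r. c i * \<phi> i t) = 0) \<longrightarrow> (\<forall>i<r. c i = 0))"

definition vspan :: "nat \<Rightarrow> (nat \<Rightarrow> real \<Rightarrow> real) \<Rightarrow> (real \<Rightarrow> real ^ 'd) set" where
  "vspan k \<psi> = {v. \<exists>W :: nat \<Rightarrow> real ^ 'd. v = (\<lambda>t. \<Sum>i<k. \<psi> i t *\<^sub>R W i)}"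

definition Y_space :: "nat \<Rightarrow> (nat \<Rightarrow> real \<Rightarrow> real) \<Rightarrow> (real \<Rightarrow> real ^ 'd) set" where
  "Y_space r \<phi> = vspan r \<phi>"

text \<open>The interval integral is oriented, so the primitives are also correct for \<open>t < t0\<close>.\<close>

definition X_space :: "real \<Rightarrow> nat \<Rightarrow> (nat \<Rightarrow> real \<Rightarrow> real) \<Rightarrow> (real \<Rightarrow> real ^ 'd) set" where
  "X_space t0 r \<phi> = vspan (Suc r)
     (\<lambda>i. case i of 0 \<Rightarrow> (\<lambda>t. 1) | Suc j \<Rightarrow> (\<lambda>t. LBINT s=ereal t0..ereal t. \<phi> j s))"

definition shift_reflect_invariant :: "(real \<Rightarrow> 'a) set \<Rightarrow> bool" where
  "shift_reflect_invariant V \<longleftrightarrow>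
     (\<forall>v\<in>V. (\<forall>c. (\<lambda>t. v (t + c)) \<in> V) \<and> (\<lambda>t. v (- t)) \<in> V)"

definition node :: "real \<Rightarrow> real \<Rightarrow> nat \<Rightarrow> real" where
  "node t0 h n = t0 + real n * h"

text \<open>Functions on \<open>[t0, t\<^sub>N]\<close> are represented by total functions; their values outside this
  interval play no role. Nothing is required at the nodes.\<close>

definition piecewise_type ::
  "real \<Rightarrow> real \<Rightarrow> nat \<Rightarrow> (real \<Rightarrow> 'a) set \<Rightarrow> (real \<Rightarrow> 'a) \<Rightarrow> bool" where
  "piecewise_type t0 h N V w \<longleftrightarrow>
     (\<forall>n<N. \<exists>g\<in>V. \<forall>t\<in>{node t0 h n<..<node t0 h (Suc n)}. w t = g t)"

text \<open>The product of two vectors of type \<open>real ^ 'd\<close> is the entrywise one. The integrand is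
  unspecified only at the finitely many nodes, where \<open>U\<close> need not be differentiable;
  this does not affect the integral.\<close>

definition FFCFE_solution ::
  "real \<Rightarrow> real \<Rightarrow> nat \<Rightarrow> nat \<Rightarrow> (nat \<Rightarrow> real \<Rightarrow> real) \<Rightarrow>
   (real ^ 'd \<Rightarrow> real ^ 'd) \<Rightarrow> real ^ 'd \<Rightarrow> (real \<Rightarrow> real ^ 'd) \<Rightarrow> bool" where
  "FFCFE_solution t0 h N r \<phi> f y0 U \<longleftrightarrow>
     continuous_on {t0..node t0 h N} U \<and>
     piecewise_type t0 h N (X_space t0 r \<phi>) U \<and>
     U t0 = y0 \<and>
     (\<forall>v. piecewise_type t0 h N (Y_space r \<phi>) v \<longrightarrow>
       ((\<lambda>t. v t * (vector_derivative U (at t) - f (U t))) has_integral 0) {t0..node t0 h N})"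

definition unique_FFCFE_solution ::
  "real \<Rightarrow> real \<Rightarrow> nat \<Rightarrow> nat \<Rightarrow> (nat \<Rightarrow> real \<Rightarrow> real) \<Rightarrow>
   (real ^ 'd \<Rightarrow> real ^ 'd) \<Rightarrow> real ^ 'd \<Rightarrow> (real \<Rightarrow> real ^ 'd) \<Rightarrow> bool" where
  "unique_FFCFE_solution t0 h N r \<phi> f y0 U \<longleftrightarrow>
     FFCFE_solution t0 h N r \<phi> f y0 U \<and>
     (\<forall>V. FFCFE_solution t0 h N r \<phi> f y0 V \<longrightarrow> (\<forall>t\<in>{t0..node t0 h N}. V t = U t))"

end

theory Submission
  imports Defs
begin

text \<open>The residual \<open>y' - f(y)\<close> of the exact solution vanishes at every point of
  the open interval, so its product with any test function integrates to zero. Since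
  \<open>y\<close> is continuous, has the right initial value and by assumption belongs to the trial
  space, it is itself a finite element solution (\<open>exact_solution_is_FFCFE_solution\<close>).
  The presumed uniqueness of the variational solution then forces \<open>U\<close> and
  \<open>y\<close> to agree.\<close>

lemma exact_solution_is_FFCFE_solution:
  fixes f :: "real ^ 'd \<Rightarrow> real ^ 'd" and y :: "real \<Rightarrow> real ^ 'd"
  assumes ode: "\<And>t. t \<in> {t0..node t0 h N} \<Longrightarrow>
      (y has_vector_derivative f (y t)) (at t within {t0..node t0 h N})"
    and init: "y t0 = y0"
    and type: "piecewise_type t0 h N (X_space t0 r \<phi>) y"
  shows "FFCFE_solution t0 h N r \<phi> f y0 y"
proof -
  let ?T = "node t0 h N"
  have "continuous_on {t0..?T} y"
    using ode has_vector_derivative_continuous continuous_on_eq_continuous_within by blast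
  moreover have "((\<lambda>t. v t * (vector_derivative y (at t) - f (y t))) has_integral 0) {t0..?T}" for v
  \<comment> \<open>Only the endpoints are excepted: there \<open>ode\<close> gives just a one-sided
    derivative, while \<open>vector_derivative y (at t)\<close> is two-sided. At inner nodes
    \<open>y\<close>, unlike a general trial function, is differentiable. Comparison with the zero
    function also yields integrability for every \<open>v\<close>.\<close>
  proof (rule has_integral_spike_finite[where S = "{t0, ?T}" and f = "\<lambda>_. 0"])
    fix t assume t: "t \<in> {t0..?T} - {t0, ?T}"
    then have "t \<in> interior {t0..?T}"
      by simp
    then have "(y has_vector_derivative f (y t)) (at t)"
      using ode[of t] t at_within_interior by fastforce
    then show "v t * (vector_derivative y (at t) - f (y t)) = 0"
      by (simp add: vector_derivative_at)
  qed auto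
  ultimately show ?thesis
    using init type by (simp add: FFCFE_solution_def)
qed

theorem theorem2p2:
  fixes H :: "real ^ ('n::finite + 'n) \<Rightarrow> real"
    and gradH f :: "real ^ ('n + 'n) \<Rightarrow> real ^ ('n + 'n)"
    and y0 :: "real ^ ('n + 'n)"
    and y U :: "real \<Rightarrow> real ^ ('n + 'n)"
    and \<phi> :: "nat \<Rightarrow> real \<Rightarrow> real"
    and t0 T h :: real
    and N r :: nat
  assumes "h > 0" and "N \<ge> 1" and "T = node t0 h N"
    and "smooth H" and "smooth f"
    and "\<And>x. GDERIV H x :> gradH x"
    and "\<And>x. f x = matrix_inv J_mat *v gradH x"
    and "r \<ge> 1"
    and "\<And>i. i < r \<Longrightarrow> smooth (\<phi> i)"
    and "lin_indep_on r \<phi> {t0..T}"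
    and "shift_reflect_invariant (Y_space r \<phi> :: (real \<Rightarrow> real ^ ('n + 'n)) set)"
    and "unique_FFCFE_solution t0 h N r \<phi> f y0 U"
    and "y t0 = y0"
    and "\<And>t. t \<in> {t0..T} \<Longrightarrow> (y has_vector_derivative f (y t)) (at t within {t0..T})"
    and "piecewise_type t0 h N (X_space t0 r \<phi>) y"
  shows "\<forall>t\<in>{t0..T}. U t = y t"
proof -
  have "FFCFE_solution t0 h N r \<phi> f y0 y"
    using assms by (intro exact_solution_is_FFCFE_solution) auto
  \<comment> \<open>The uniqueness clause, taken at \<open>V = y\<close>, gives equality on the
    whole closed interval, nodes included.\<close>
  with \<open>unique_FFCFE_solution t0 h N r \<phi> f y0 U\<close> \<open>T = node t0 h N\<close> show ?thesis
    by (simp add: unique_FFCFE_solution_def)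
qed

end
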